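(* Let $q_1,q_2\in\mathbb Q_{>0}$, $a_1,a_2,b_1,b_2\in\mathbb N$ and $n_1,n_2,m_1,m_2\in\mathbb Z$. If the pattern $$x,\quad y,\quad q_1(a_1x+n_1)(b_1y+m_1),\quad q_2(a_2x+n_2)(b_2y+m_2)$$ is partition regular, then at least one of the following holds (equalities being identities of polynomials in $x,y$): 1. $q_1(a_1x+n_1)(b_1y+m_1)=q_2(a_2x+n_2)(b_2y+m_2)$; 2. $q_1(a_1x+n_1)(b_1y+m_1)=q_2(b_2x+m_2)(a_2y+n_2)$; 3. $q_1a_1b_1=q_2a_2b_2$ and, setting $q:=q_1a_1b_1=q_2a_2b_2$, the pattern is $x,\ y,\ qxy,\ qxy+x$ or the symmetric one $x,\ y,\ qxy,\ qxy+y$ (up to the order in which the terms are listed).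
   Context: $\mathbb N$ denotes the set of positive integers ($0\notin\mathbb N$). A pattern $f_1(x,y),\dots,f_k(x,y)$ (with the $f_i$ rational-valued functions) is called partition regular if, for every finite colouring (partition into finitely many pieces) of $\mathbb N$, the set of monochromatic $k$-tuples $(f_1(u,v),\dots,f_k(u,v))$ with $u,v\in\mathbb N$ is infinite; here a tuple is monochromatic if all its entries belong to $\mathbb N$ and lie in the same colour. *)

theory Defs
  imports
    Complex_Main
    "HOL-Library.Multiset"
    "HOL-Library.Disjoint_Sets"
    "HOL-Computational_Algebra.Polynomial"
begin

text \<open>
  A colouring of the positive integers is a partition of \<open>{1..}\<close> into finitely many
  cells. A tuple of rationals is monochromatic if all entries are (images of) elements of one
  cell; in particular all entries are then positive integers.
\<close>

definition monochromatic :: "nat set set \<Rightarrow> rat list \<Rightarrow> bool" where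
  "monochromatic C t \<longleftrightarrow> (\<exists>A\<in>C. \<forall>r\<in>set t. r \<in> of_nat ` A)"

text \<open>What has to be infinite is the set of value tuples, not the set of parameters \<open>(u, v)\<close>.\<close>

definition partition_regular :: "(nat \<Rightarrow> nat \<Rightarrow> rat) list \<Rightarrow> bool" where
  "partition_regular fs \<longleftrightarrow>
     (\<forall>C. finite C \<and> partition_on {1..} C \<longrightarrow>
        infinite {t. monochromatic C t \<and> (\<exists>u\<ge>1. \<exists>v\<ge>1. t = map (\<lambda>f. f u v) fs)})"

text \<open>
  Polynomials in \<open>x\<close> and \<open>y\<close> over the rationals are elements of \<open>rat poly poly\<close>, with \<open>x\<close> the
  variable of the coefficient ring and \<open>y\<close> the outer variable.
\<close>

definition const2 :: "rat \<Rightarrow> rat poly poly" where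
  "const2 c = [:[:c:]:]"

definition var_x :: "rat poly poly" where
  "var_x = [:[:0, 1:]:]"

definition var_y :: "rat poly poly" where
  "var_y = [:0, 1:]"

definition eval2 :: "rat poly poly \<Rightarrow> nat \<Rightarrow> nat \<Rightarrow> rat" where
  "eval2 p u v = poly (poly p [:of_nat v:]) (of_nat u)"

definition lin_prod :: "rat \<Rightarrow> nat \<Rightarrow> int \<Rightarrow> nat \<Rightarrow> int \<Rightarrow> rat poly poly" where
  "lin_prod q a n b m =
     const2 q * (of_nat a * var_x + of_int n) * (of_nat b * var_y + of_int m)"

lemma eval2_simps [simp]:
  "eval2 (const2 c) u v = c"
  "eval2 var_x u v = of_nat u"
  "eval2 var_y u v = of_nat v"
  "eval2 (of_nat k) u v = of_nat k"
  "eval2 (of_int i) u v = of_int i"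
  "eval2 (p + r) u v = eval2 p u v + eval2 r u v"
  "eval2 (p * r) u v = eval2 p u v * eval2 r u v"
  by (simp_all add: eval2_def const2_def var_x_def var_y_def of_nat_poly of_int_poly)

lemma eval2_lin_prod:
  "eval2 (lin_prod q a n b m) u v =
     q * (of_nat a * of_nat u + of_int n) * (of_nat b * of_nat v + of_int m)"
  by (simp add: lin_prod_def)

end

theory Submission
  imports Defs "HOL-Computational_Algebra.Primes"
begin

text \<open>
  Comparing sizes forces equal leading coefficients \<open>Q\<close>. Write the two forms as
  \<open>Q (x + s) (y + t)\<close> and \<open>Q (x + s') (y + t')\<close>. Their difference is linear, so if all four
  entries agree modulo a high power of 2, they are 2-adically close to the rational \<open>\<rho>\<close> given by
  \<open>(s + t - s' - t') \<rho> = s' t' - s t\<close>, which is then a fixed point of both forms on the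
  diagonal; if the coefficient of \<open>\<rho>\<close> vanishes, so does the right-hand side and the forms agree
  up to exchanging \<open>x\<close> and \<open>y\<close>. In the coordinates \<open>X = x - \<rho>\<close>, \<open>Y = y - \<rho>\<close> each form becomes
  \<open>Q (X Y + \<alpha> X + \<beta> Y)\<close>. If the 2-adic valuations of \<open>X\<close> and \<open>Y\<close> are far apart, the leading
  2-adic term shows that the relevant coefficients \<open>Q \<alpha>\<close>, \<open>Q \<beta>\<close> are 0 or 1, which leaves
  only the listed patterns. If the valuations are equal, to \<open>v\<close> say, then \<open>Q (\<alpha> + \<beta>)\<close> is 0
  or 1; the value 1 is impossible because the term \<open>X Y\<close> disturbs the bits at position \<open>2 v\<close>,
  and \<open>\<alpha> + \<beta> = 0\<close> for both forms contradicts \<open>s + t \<noteq> s' + t'\<close>.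
\<close>

section \<open>Large monochromatic quadruples from partition regularity\<close>

text \<open>Refining \<open>\<chi>\<close> by \<open>min n (Suc M)\<close> gives each number up to
  \<open>M\<close> colours of its own. Hence a monochromatic tuple lies entirely above
  \<open>M\<close> unless all its entries are one and the same number at most
  \<open>M\<close>.\<close>

lemma partition_regular_monochromatic:
  fixes \<chi> :: "nat \<Rightarrow> 'c"
  assumes pr: "partition_regular (map eval2 [var_x, var_y, f, g])"
    and fin: "finite (range \<chi>)"
  obtains u v F G where "u > M" "v > M" "F > M" "G > M"
    "\<chi> v = \<chi> u" "\<chi> F = \<chi> u" "\<chi> G = \<chi> u"
    "of_nat F = eval2 f u v" "of_nat G = eval2 g u v"
proof -
  define \<psi> where "\<psi> n = (min n (Suc M), \<chi> n)" for n
  define C where "C = (\<lambda>c. {n. n \<ge> 1 \<and> \<psi> n = c}) ` (\<psi> ` {1..})"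
  have "range \<psi> \<subseteq> {..Suc M} \<times> range \<chi>"
    by (auto simp: \<psi>_def)
  then have "finite (range \<psi>)"
    using fin by (meson finite_SigmaI finite_atMost finite_subset)
  then have "finite C"
    unfolding C_def by (meson finite_imageI finite_subset image_mono top_greatest)
  moreover have "partition_on {1..} C"
    by (rule partition_onI) (auto simp: C_def disjnt_def)
  ultimately have inf: "infinite {t. monochromatic C t \<and>
      (\<exists>u\<ge>1. \<exists>v\<ge>1. t = map (\<lambda>f. f u v) (map eval2 [var_x, var_y, f, g]))}" (is "infinite ?S")
    using pr unfolding partition_regular_def by blast
  \<comment> \<open>The tuples with \<open>u = v \<le> M\<close> form a finite set, so infinitely
    many value tuples leave one outside it.\<close>
  let ?t = "\<lambda>u. map (\<lambda>f. f u u) (map eval2 [var_x, var_y, f, g])"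
  have "\<not> ?S \<subseteq> ?t ` {..M}"
    using inf finite_surj by blast
  then obtain t u v where t: "monochromatic C t" "t \<notin> ?t ` {..M}"
    "t = map (\<lambda>f. f u v) (map eval2 [var_x, var_y, f, g])"
    by blast
  from t(1,3) obtain A where A: "A \<in> C" "(of_nat u :: rat) \<in> of_nat ` A" "(of_nat v :: rat) \<in> of_nat ` A"
    "eval2 f u v \<in> of_nat ` A" "eval2 g u v \<in> of_nat ` A"
    unfolding monochromatic_def by auto
  then obtain F G where FG: "F \<in> A" "G \<in> A" "eval2 f u v = of_nat F" "eval2 g u v = of_nat G"
    by auto
  have uv: "u \<in> A" "v \<in> A"
    using A(2,3) by auto
  obtain c where c: "\<And>n. n \<in> A \<Longrightarrow> \<psi> n = c"
    using A(1) unfolding C_def by auto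
  have eq: "\<psi> v = \<psi> u" "\<psi> F = \<psi> u" "\<psi> G = \<psi> u"
    using c uv FG(1,2) by simp_all
  have "u > M"
  proof (rule ccontr)
    assume "\<not> u > M"
    with eq(1) have "v = u" "u \<le> M"
      by (auto simp: \<psi>_def min_def split: if_splits)
    with t(2,3) show False by blast
  qed
  then show thesis
    using that[of u v F G] eq FG(3,4) by (auto simp: \<psi>_def min_def split: if_splits)
qed

section \<open>Equality of the leading coefficients\<close>

lemma ln_linear_minus_ln_tendsto_0:
  fixes a s :: real
  assumes "a > 0"
  shows "(\<lambda>n::nat. ln (a * n + s) - ln n) \<longlonglongrightarrow> ln a"
proof -
  have lim: "(\<lambda>n::nat. a + s / n) \<longlonglongrightarrow> a"
    using tendsto_add[OF tendsto_const lim_const_over_n, of a s] by simp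
  have "\<forall>\<^sub>F n::nat in sequentially. a + s / n > 0"
    using order_tendstoD(1)[OF lim assms] .
  then have "\<forall>\<^sub>F n::nat in sequentially. ln (a + s / n) = ln (a * n + s) - ln n"
    using eventually_gt_at_top[of 0]
  proof eventually_elim
    case (elim n)
    then have "a * n + s = (a + s / n) * n" by (simp add: field_simps)
    then show ?case using elim by (simp add: ln_mult)
  qed
  moreover have "(\<lambda>n::nat. ln (a + s / n)) \<longlonglongrightarrow> ln a"
    using lim assms by (intro tendsto_ln) auto
  ultimately show ?thesis
    by (rule Lim_transform_eventually[rotated])
qed

text \<open>For large \<open>x\<close> and \<open>y\<close> the logarithms of the two product values
  differ by almost the constant \<open>L\<close>, the logarithm of the quotient of the leading
  coefficients. If \<open>L \<noteq> 0\<close>, colouring \<open>n\<close> by its logarithm on a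
  scale proportional to \<open>\<bar>L\<bar>\<close> separates the two values.\<close>

lemma leading_coeff_eq:
  fixes q1 q2 :: rat and a1 a2 b1 b2 :: nat and n1 n2 m1 m2 :: int
  assumes pos: "q1 > 0" "q2 > 0" "a1 > 0" "a2 > 0" "b1 > 0" "b2 > 0"
    and pr: "partition_regular
           (map eval2 [var_x, var_y, lin_prod q1 a1 n1 b1 m1, lin_prod q2 a2 n2 b2 m2])"
  shows "q1 * of_nat a1 * of_nat b1 = q2 * of_nat a2 * of_nat b2"
proof (rule ccontr)
  assume neq: "\<not> ?thesis"
  define Q1 Q2 where "Q1 = real_of_rat q1 * a1 * b1" and "Q2 = real_of_rat q2 * a2 * b2"
  have Q: "Q1 > 0" "Q2 > 0"
    using pos by (simp_all add: Q1_def Q2_def)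
  have "Q1 = real_of_rat (q1 * of_nat a1 * of_nat b1)" "Q2 = real_of_rat (q2 * of_nat a2 * of_nat b2)"
    by (simp_all add: Q1_def Q2_def of_rat_mult)
  with neq have "Q1 \<noteq> Q2"
    by (metis of_rat_eq_iff)
  define L where "L = ln Q1 - ln Q2"
  have L: "L \<noteq> 0"
    using Q \<open>Q1 \<noteq> Q2\<close> by (simp add: L_def)
  \<comment> \<open>Four linear factors, each with logarithmic error below \<open>e\<close>, give a
    total error below \<open>\<bar>L\<bar> / 4\<close>, which becomes \<open>1 / 2\<close> on the
    scale used for the colours.\<close>
  define e where "e = \<bar>L\<bar> / 16"
  have e: "e > 0" using L by (simp add: e_def)
  have ev: "\<forall>\<^sub>F n::nat in sequentially. \<bar>ln (real a * n + s) - ln n - ln a\<bar> < e \<and> real a * n + s > 0"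
    if "a > 0" for a :: nat and s :: real
  proof (rule eventually_conj)
    show "\<forall>\<^sub>F n::nat in sequentially. \<bar>ln (real a * n + s) - ln n - ln a\<bar> < e"
      using tendstoD[OF ln_linear_minus_ln_tendsto_0[of "real a" s] e] that by (simp add: dist_real_def)
    show "\<forall>\<^sub>F n::nat in sequentially. real a * n + s > 0"
      using eventually_gt_at_top[of "nat \<lceil>\<bar>s\<bar>\<rceil>"]
    proof eventually_elim
      case (elim n)
      then have "\<bar>s\<bar> < real n" by linarith
      also have "\<dots> \<le> real a * real n"
        using that mult_right_mono[of 1 "real a" "real n"] by simp
      finally show ?case by linarith
    qed
  qed
  have "\<forall>\<^sub>F n::nat in sequentially.
      (\<bar>ln (real a1 * n + n1) - ln n - ln a1\<bar> < e \<and> real a1 * n + n1 > 0) \<and>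
      (\<bar>ln (real b1 * n + m1) - ln n - ln b1\<bar> < e \<and> real b1 * n + m1 > 0) \<and>
      (\<bar>ln (real a2 * n + n2) - ln n - ln a2\<bar> < e \<and> real a2 * n + n2 > 0) \<and>
      (\<bar>ln (real b2 * n + m2) - ln n - ln b2\<bar> < e \<and> real b2 * n + m2 > 0)"
    by (intro eventually_conj ev pos)
  then obtain M where M: "\<And>n::nat. n \<ge> M \<Longrightarrow>
      (\<bar>ln (real a1 * n + n1) - ln n - ln a1\<bar> < e \<and> real a1 * n + n1 > 0) \<and>
      (\<bar>ln (real b1 * n + m1) - ln n - ln b1\<bar> < e \<and> real b1 * n + m1 > 0) \<and>
      (\<bar>ln (real a2 * n + n2) - ln n - ln a2\<bar> < e \<and> real a2 * n + n2 > 0) \<and>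
      (\<bar>ln (real b2 * n + m2) - ln n - ln b2\<bar> < e \<and> real b2 * n + m2 > 0)"
    unfolding eventually_sequentially by blast
  \<comment> \<open>On this scale the shift \<open>L\<close> has length 2, so with an error below
    \<open>1 / 2\<close> the floors differ by 1, 2 or 3, never by a multiple of 4.\<close>
  define \<chi> :: "nat \<Rightarrow> int" where "\<chi> n = \<lfloor>2 * ln n / \<bar>L\<bar>\<rfloor> mod 4" for n
  have "range \<chi> \<subseteq> {0..<4}" by (auto simp: \<chi>_def)
  then have fin: "finite (range \<chi>)" by (rule finite_subset) simp
  obtain u v F G where uv: "u > M" "v > M" "F > M" "G > M"
    and col: "\<chi> v = \<chi> u" "\<chi> F = \<chi> u" "\<chi> G = \<chi> u"
    and F: "of_nat F = eval2 (lin_prod q1 a1 n1 b1 m1) u v"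
    and G: "of_nat G = eval2 (lin_prod q2 a2 n2 b2 m2) u v"
    by (rule partition_regular_monochromatic[OF pr fin])
  have "real F = real_of_rat (of_nat F)" "real G = real_of_rat (of_nat G)"
    by simp_all
  then have FG: "real F = real_of_rat q1 * (real a1 * u + n1) * (real b1 * v + m1)"
    "real G = real_of_rat q2 * (real a2 * u + n2) * (real b2 * v + m2)"
    unfolding F G eval2_lin_prod by (simp_all add: of_rat_mult of_rat_add)
  have u: "\<bar>ln (real a1 * u + n1) - ln u - ln a1\<bar> < e" "real a1 * u + n1 > 0"
      "\<bar>ln (real a2 * u + n2) - ln u - ln a2\<bar> < e" "real a2 * u + n2 > 0"
    using M[of u] uv by auto
  have v: "\<bar>ln (real b1 * v + m1) - ln v - ln b1\<bar> < e" "real b1 * v + m1 > 0"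
      "\<bar>ln (real b2 * v + m2) - ln v - ln b2\<bar> < e" "real b2 * v + m2 > 0"
    using M[of v] uv by auto
  have "ln F = ln (real_of_rat q1) + ln (real a1 * u + n1) + ln (real b1 * v + m1)"
    "ln G = ln (real_of_rat q2) + ln (real a2 * u + n2) + ln (real b2 * v + m2)"
    unfolding FG using u v pos by (simp_all add: ln_mult)
  moreover have "L = ln (real_of_rat q1) + ln a1 + ln b1 - (ln (real_of_rat q2) + ln a2 + ln b2)"
    using pos by (simp add: L_def Q1_def Q2_def ln_mult)
  ultimately have close: "\<bar>ln F - ln G - L\<bar> < 4 * e"
    using u(1,3) v(1,3) by linarith
  define f g where "f = 2 * ln F / \<bar>L\<bar>" and "g = 2 * ln G / \<bar>L\<bar>"
  have "f - g - 2 * sgn L = 2 * (ln F - ln G - L) / \<bar>L\<bar>"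
    using L by (simp add: f_def g_def diff_divide_distrib right_diff_distrib flip: sgn_div_norm)
      (simp add: sgn_real_def)
  then have "\<bar>f - g - 2 * sgn L\<bar> = 2 * \<bar>ln F - ln G - L\<bar> / \<bar>L\<bar>"
    by (simp only: abs_divide abs_mult abs_numeral abs_abs)
  also have "\<dots> < 1 / 2"
    using close L by (simp add: e_def field_simps)
  finally have diff: "\<bar>f - g - 2 * sgn L\<bar> < 1 / 2" .
  define i j where "i = \<lfloor>f\<rfloor>" and "j = \<lfloor>g\<rfloor>"
  have ij: "of_int i \<le> f" "f < of_int i + 1" "of_int j \<le> g" "g < of_int j + 1"
    unfolding i_def j_def by linarith+
  consider "sgn L = 1" | "sgn L = - 1"
    using L by (metis linorder_neqE_linordered_idom sgn_neg sgn_pos)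
  then have "i - j \<noteq> 0 \<and> \<bar>i - j\<bar> < 4"
  proof cases
    case 1
    with diff have "1 < f - g" "f - g < 3" by (simp_all only: abs_less_iff) linarith+
    with ij have "(0::real) < of_int (i - j)" "of_int (i - j) < (4::real)"
      unfolding of_int_diff by linarith+
    then show ?thesis by simp
  next
    case 2
    with diff have "1 < g - f" "g - f < 3" by (simp_all only: abs_less_iff) linarith+
    with ij have "(0::real) < of_int (j - i)" "of_int (j - i) < (4::real)"
      unfolding of_int_diff by linarith+
    then show ?thesis by simp
  qed
  moreover have "\<chi> F = \<chi> G"
    using col by simp
  then have "4 dvd i - j"
    by (simp add: \<chi>_def i_def j_def f_def g_def mod_eq_dvd_iff)
  ultimately show False
    using dvd_imp_le_int[of "i - j" 4] by simp
qed

section \<open>A finite 2-adic colouring\<close>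

text \<open>The first two components are leading 2-adic data: the valuation \<open>v\<close> modulo
  \<open>N\<close> and the last \<open>N\<close> bits of the odd part. The third is a window of bits
  around position \<open>2 * v\<close>, where the product of two numbers of valuation
  \<open>v\<close> has its lowest nonzero bit. Truncation in \<open>2 * v - N\<close> does no harm,
  as the window is only used when \<open>N \<le> v\<close>.\<close>

definition dyadic_colour :: "nat \<Rightarrow> int \<Rightarrow> nat \<times> int \<times> int" where
  "dyadic_colour N z = (let v = multiplicity 2 z in
     (v mod N, (z div 2 ^ v) mod 2 ^ N, (z div 2 ^ (2 * v - N)) mod 2 ^ (2 * N)))"

lemma finite_range_dyadic_colour:
  assumes "N > 0"
  shows "finite (range (dyadic_colour N))"
proof (rule finite_subset)
  show "range (dyadic_colour N) \<subseteq> {..<N} \<times> {0..<2 ^ N} \<times> {0..<2 ^ (2 * N)}"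
    using assms by (auto simp: dyadic_colour_def Let_def)
qed simp

lemma odd_part:
  fixes z :: int
  assumes "z \<noteq> 0"
  shows "z = 2 ^ multiplicity 2 z * (z div 2 ^ multiplicity 2 z)" "odd (z div 2 ^ multiplicity 2 z)"
  using assms by (simp_all add: multiplicity_dvd multiplicity_decompose)

lemma two_power_le_multiplicity:
  fixes z :: int
  assumes "z \<noteq> 0" "2 ^ N dvd z"
  shows "N \<le> multiplicity 2 z"
  using assms by (simp add: power_dvd_iff_le_multiplicity)

text \<open>Distinct members of a residue class are at least \<open>N\<close> apart. For valuations
  this yields the split into equal and far apart.\<close>

lemma mod_eq_gap:
  fixes a b N :: nat
  assumes "a mod N = b mod N"
  shows "a = b \<or> a + N \<le> b \<or> b + N \<le> a"
proof -
  have "a + N \<le> b" if "a < b" "a mod N = b mod N" for a b :: nat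
  proof -
    have "N dvd b - a"
      using that by (metis less_imp_le mod_eq_dvd_iff_nat)
    with that(1) have "N \<le> b - a" by (simp add: dvd_imp_le)
    with that(1) show ?thesis by simp
  qed
  with assms show ?thesis by (metis nat_neq_iff)
qed

lemma exists_two_power_gt:
  fixes S :: "int set"
  assumes "finite S"
  obtains N where "N > 0" "\<forall>b\<in>S. \<bar>b\<bar> < 2 ^ N"
proof -
  define N where "N = nat (\<Sum>b\<in>S. \<bar>b\<bar>) + 1"
  have "\<bar>b\<bar> < 2 ^ N" if "b \<in> S" for b
  proof -
    have "\<bar>b\<bar> \<le> (\<Sum>b\<in>S. \<bar>b\<bar>)"
      using assms that by (intro member_le_sum) auto
    also have "\<dots> \<le> int N" by (simp add: N_def)
    also have "\<dots> < 2 ^ N" by (rule of_nat_less_two_power)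
    finally show ?thesis .
  qed
  then show thesis using that[of N] by (simp add: N_def)
qed

text \<open>An odd factor cancels modulo a power of 2, and 0 is the only multiple of
  \<open>2 ^ N\<close> of smaller absolute value. This turns congruences between fixed coefficients
  into equalities.\<close>

lemma dyadic_small_eq_0:
  fixes b u :: int
  assumes "2 ^ N dvd b * u" "odd u" "\<bar>b\<bar> < 2 ^ N"
  shows "b = 0"
proof -
  have "coprime (2 ^ N) u" using assms(2) by simp
  then have "2 ^ N dvd b"
    using assms(1) coprime_dvd_mult_left_iff by blast
  then show ?thesis
    using assms(3) dvd_imp_le_int[of b "2 ^ N"] by force
qed

section \<open>Comparison of leading 2-adic terms\<close>

text \<open>If the valuations differed, they would be at least \<open>N\<close> apart, and the term
  of lower valuation would have a coefficient divisible by \<open>2 ^ N\<close>. So they agree; the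
  odd parts then agree modulo \<open>2 ^ N\<close>, and cancelling them leaves
  \<open>2 ^ N dvd A - B\<close>.\<close>

lemma dyadic_leading_coeff:
  fixes A B w z :: int
  assumes nz: "w \<noteq> 0" "z \<noteq> 0"
    and col: "dyadic_colour N w = dyadic_colour N z"
    and dvd: "2 ^ (multiplicity 2 z + N) dvd A * w - B * z"
    and AB: "A \<noteq> 0" "B \<noteq> 0" "\<bar>A\<bar> < 2 ^ N" "\<bar>B\<bar> < 2 ^ N" "\<bar>A - B\<bar> < 2 ^ N"
  shows "A = B" "multiplicity 2 w = multiplicity 2 z"
proof -
  define v r U V where "v = multiplicity 2 z" and "r = multiplicity 2 w"
    and "U = z div 2 ^ v" and "V = w div 2 ^ r"
  have z: "z = 2 ^ v * U" "odd U" and w: "w = 2 ^ r * V" "odd V"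
    using odd_part nz unfolding v_def r_def U_def V_def by blast+
  have mods: "r mod N = v mod N" "V mod 2 ^ N = U mod 2 ^ N"
    using col by (simp_all add: dyadic_colour_def Let_def v_def r_def U_def V_def)
  have eq: "r = v"
  proof (rule ccontr)
    assume "r \<noteq> v"
    then consider "v + N \<le> r" | "r + N \<le> v"
      using mod_eq_gap mods(1) by blast
    then show False
    proof cases
      case 1
      then have "2 ^ (v + N) dvd A * w"
        unfolding w(1) by (simp add: dvd_mult le_imp_power_dvd)
      then have "2 ^ (v + N) dvd B * z"
        using dvd unfolding v_def[symmetric] by (simp add: dvd_diff_right_iff)
      then have "2 ^ N dvd B * U"
        by (simp add: z(1) power_add mult.left_commute)
      then show False using dyadic_small_eq_0 z(2) AB by blast
    next
      case 2
      then have "2 ^ (r + N) dvd B * z"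
        unfolding z(1) by (simp add: dvd_mult le_imp_power_dvd)
      moreover have "2 ^ (r + N) dvd A * w - B * z"
        using dvd 2 unfolding v_def[symmetric]
        by (metis dvd_trans le_imp_power_dvd le_add1 le_trans)
      ultimately have "2 ^ (r + N) dvd A * w"
        by (simp add: dvd_diff_left_iff)
      then have "2 ^ N dvd A * V"
        by (simp add: w(1) power_add mult.left_commute)
      then show False using dyadic_small_eq_0 w(2) AB by blast
    qed
  qed
  then show "multiplicity 2 w = multiplicity 2 z"
    by (simp add: v_def r_def)
  have "A * w - B * z = 2 ^ v * (A * V - B * U)"
    by (simp add: z(1) w(1) eq algebra_simps)
  then have "2 ^ N dvd A * V - B * U"
    using dvd unfolding v_def[symmetric] by (simp add: power_add)
  moreover have "2 ^ N dvd A * (V - U)"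
    using mods(2) by (simp add: mod_eq_dvd_iff)
  moreover have "(A - B) * U = (A * V - B * U) - A * (V - U)"
    by (simp add: algebra_simps)
  ultimately have "2 ^ N dvd (A - B) * U"
    by (metis dvd_diff)
  then have "A - B = 0"
    using dyadic_small_eq_0 z(2) AB by blast
  then show "A = B" by simp
qed

text \<open>Cutting both numbers at bit \<open>k\<close>, the upper parts differ by a multiple of
  \<open>2 ^ l\<close>, and the lower parts only contribute the carry \<open>e\<close>.\<close>

lemma mod_window_diff:
  fixes w z :: int
  assumes "(w div 2 ^ k) mod 2 ^ l = (z div 2 ^ k) mod 2 ^ l"
  obtains i e where "w - z = 2 ^ (k + l) * i + e" "\<bar>e\<bar> < 2 ^ k"
proof -
  obtain i where i: "w div 2 ^ k - z div 2 ^ k = 2 ^ l * i"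
    using assms by (metis mod_eq_dvd_iff dvdE)
  have "w - z = 2 ^ k * (w div 2 ^ k - z div 2 ^ k) + (w mod 2 ^ k - z mod 2 ^ k)"
    by (simp add: algebra_simps)
  then have "w - z = 2 ^ (k + l) * i + (w mod 2 ^ k - z mod 2 ^ k)"
    by (simp add: i power_add)
  moreover have "0 \<le> w mod 2 ^ k" "w mod 2 ^ k < 2 ^ k" "0 \<le> z mod 2 ^ k" "z mod 2 ^ k < 2 ^ k"
    by simp_all
  then have "\<bar>w mod 2 ^ k - z mod 2 ^ k\<bar> < 2 ^ k" by linarith
  ultimately show thesis using that by blast
qed

text \<open>
  The bits of \<open>z\<close> around position \<open>2 * multiplicity 2 z\<close> are part of the colour, so in
  \<open>w - y\<close> and \<open>x - y\<close> they vanish up to a carry, whereas \<open>C * x * y\<close> has a nonzero bit there.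
\<close>

lemma no_quadratic_term_equal_multiplicity:
  fixes A C P w x y :: int
  assumes nz: "w \<noteq> 0" "x \<noteq> 0" "y \<noteq> 0"
    and col: "dyadic_colour N w = dyadic_colour N y" "dyadic_colour N x = dyadic_colour N y"
    and mult: "multiplicity 2 w = multiplicity 2 y" "multiplicity 2 x = multiplicity 2 y"
    and div: "2 ^ N dvd y"
    and eq: "A * (w - y) - P * (x - y) = C * x * y"
    and small: "\<bar>A\<bar> + \<bar>P\<bar> < 2 ^ N" "\<bar>C\<bar> < 2 ^ N"
  shows "C = 0"
proof -
  define v X Y where "v = multiplicity 2 y" and "X = x div 2 ^ v" and "Y = y div 2 ^ v"
  have x: "x = 2 ^ v * X" "odd X" and y: "y = 2 ^ v * Y" "odd Y"
    using odd_part[OF nz(2)] odd_part[OF nz(3)] mult unfolding v_def X_def Y_def by simp_all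
  have "N \<le> v"
    unfolding v_def using two_power_le_multiplicity nz(3) div by blast
  define k where "k = 2 * v - N"
  have k: "k + N = 2 * v" "k + 2 * N = 2 * v + N"
    using \<open>N \<le> v\<close> by (simp_all add: k_def)
  have win: "(w div 2 ^ k) mod 2 ^ (2 * N) = (y div 2 ^ k) mod 2 ^ (2 * N)"
    "(x div 2 ^ k) mod 2 ^ (2 * N) = (y div 2 ^ k) mod 2 ^ (2 * N)"
    using col mult by (simp_all add: dyadic_colour_def Let_def v_def k_def)
  obtain i d where i: "w - y = 2 ^ (k + 2 * N) * i + d" "\<bar>d\<bar> < 2 ^ k"
    using mod_window_diff[OF win(1)] .
  obtain j e where j: "x - y = 2 ^ (k + 2 * N) * j + e" "\<bar>e\<bar> < 2 ^ k"
    using mod_window_diff[OF win(2)] .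
  \<comment> \<open>\<open>T\<close> gathers everything except the carries \<open>d\<close> and
    \<open>e\<close>, divided by \<open>2 ^ (2 * v)\<close>. The carries are too small to produce a
    nonzero multiple of that power, so \<open>T = 0\<close> and \<open>2 ^ N\<close> divides
    \<open>C * (X * Y)\<close>.\<close>
  define T where "T = C * (X * Y) - 2 ^ N * (A * i - P * j)"
  have p: "(2::int) ^ (k + 2 * N) = 2 ^ (2 * v) * 2 ^ N"
    by (simp add: k power_add)
  have "C * x * y = 2 ^ (2 * v) * (C * (X * Y))"
    unfolding x(1) y(1) mult_2 power_add by (simp only: mult_ac)
  moreover have "A * (w - y) - P * (x - y) =
      2 ^ (2 * v) * (2 ^ N * (A * i - P * j)) + (A * d - P * e)"
    unfolding i(1) j(1) p by (simp add: algebra_simps)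
  ultimately have "2 ^ (2 * v) * (C * (X * Y)) =
      2 ^ (2 * v) * (2 ^ N * (A * i - P * j)) + (A * d - P * e)"
    using eq by metis
  then have T: "2 ^ (2 * v) * T = A * d - P * e"
    unfolding T_def right_diff_distrib[of "2 ^ (2 * v)"] by linarith
  have "\<bar>A * d - P * e\<bar> \<le> \<bar>A\<bar> * \<bar>d\<bar> + \<bar>P\<bar> * \<bar>e\<bar>"
    by (metis abs_mult abs_triangle_ineq4)
  also have "\<dots> \<le> \<bar>A\<bar> * 2 ^ k + \<bar>P\<bar> * 2 ^ k"
    using i(2) j(2) by (intro add_mono mult_left_mono) auto
  also have "\<dots> < 2 ^ N * 2 ^ k"
    using small(1) by (simp flip: distrib_right)
  also have "\<dots> = 2 ^ (2 * v)"
    by (metis k(1) power_add mult.commute)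
  finally have "2 ^ (2 * v) * \<bar>T\<bar> < 2 ^ (2 * v) * 1"
    by (simp flip: T add: abs_mult)
  then have "\<bar>T\<bar> < 1"
    by (subst (asm) mult_less_cancel_left_pos) simp_all
  then have "C * (X * Y) = 2 ^ N * (A * i - P * j)"
    by (simp add: T_def)
  then show ?thesis
    using dyadic_small_eq_0[of N C "X * Y"] x(2) y(2) small(2) by simp
qed

section \<open>2-adic constraints on the linear coefficients\<close>

text \<open>The term \<open>P * x\<close> dominates 2-adically, so a nonzero \<open>P\<close> must
  equal \<open>A\<close>. If \<open>P = 0\<close>, the right-hand side is
  \<open>y * (C * x + R)\<close> with \<open>x\<close> divisible by \<open>2 ^ N\<close>, so
  \<open>R * y\<close> dominates and a nonzero \<open>R\<close> must equal \<open>A\<close>.\<close>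

lemma dyadic_coeffs_of_gap:
  fixes A C P R w x y :: int
  assumes nz: "w \<noteq> 0" "x \<noteq> 0" "y \<noteq> 0"
    and col: "dyadic_colour N w = dyadic_colour N x" "dyadic_colour N y = dyadic_colour N x"
    and gap: "multiplicity 2 x + N \<le> multiplicity 2 y"
    and div: "2 ^ N dvd x"
    and eq: "A * w = C * x * y + P * x + R * y"
    and small: "A \<noteq> 0" "\<bar>A\<bar> + \<bar>P\<bar> + \<bar>R\<bar> < 2 ^ N"
  shows "P = A \<or> P = 0 \<and> (R = 0 \<or> R = A)"
proof (cases "P = 0")
  case False
  have "A * w - P * x = y * (C * x + R)"
    using eq by (simp add: algebra_simps)
  moreover have "2 ^ (multiplicity 2 x + N) dvd y"
    using gap multiplicity_dvd'[of _ 2 y] by simp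
  ultimately have "2 ^ (multiplicity 2 x + N) dvd A * w - P * x"
    by simp
  then have "A = P"
    using False small by (intro dyadic_leading_coeff(1)[OF nz(1,2) col(1)]) auto
  then show ?thesis by simp
next
  case P: True
  have "R = A" if "R \<noteq> 0"
  proof -
    have "A * w - R * y = C * (y * x)"
      using eq P by (simp add: algebra_simps)
    moreover have "2 ^ multiplicity 2 y * 2 ^ N dvd y * x"
      by (intro mult_dvd_mono multiplicity_dvd div)
    ultimately have "2 ^ (multiplicity 2 y + N) dvd A * w - R * y"
      by (simp add: power_add)
    then have "A = R"
      using that small col by (intro dyadic_leading_coeff(1)[OF nz(1,3)]) auto
    then show ?thesis by simp
  qed
  with P show ?thesis by blast
qed

text \<open>Here \<open>x\<close> and \<open>y\<close> agree to \<open>N\<close> bits beyond their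
  valuation, so the leading term is \<open>(P + R) * x\<close> and a nonzero \<open>P + R\<close>
  equals \<open>A\<close>. Subtracting \<open>A * y\<close> then isolates \<open>C * x * y\<close>
  against differences that vanish on the bit window, forcing \<open>C = 0\<close>.\<close>

lemma dyadic_coeffs_of_equal_multiplicity:
  fixes A C P R w x y :: int
  assumes nz: "w \<noteq> 0" "x \<noteq> 0" "y \<noteq> 0"
    and col: "dyadic_colour N w = dyadic_colour N x" "dyadic_colour N y = dyadic_colour N x"
    and mult: "multiplicity 2 y = multiplicity 2 x"
    and div: "2 ^ N dvd x" "2 ^ N dvd y"
    and eq: "A * w = C * x * y + P * x + R * y"
    and small: "A \<noteq> 0" "C \<noteq> 0" "\<bar>C\<bar> < 2 ^ N" "\<bar>A\<bar> + \<bar>P\<bar> + \<bar>R\<bar> < 2 ^ N"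
  shows "P + R = 0"
proof (rule ccontr)
  assume PR: "P + R \<noteq> 0"
  define v X Y where "v = multiplicity 2 x" and "X = x div 2 ^ v" and "Y = y div 2 ^ v"
  have x: "x = 2 ^ v * X" and y: "y = 2 ^ v * Y"
    using odd_part[OF nz(2)] odd_part[OF nz(3)] mult unfolding v_def X_def Y_def by simp_all
  have "Y mod 2 ^ N = X mod 2 ^ N"
    using col(2) mult by (simp add: dyadic_colour_def Let_def v_def X_def Y_def)
  then have "2 ^ (v + N) dvd y - x"
    by (simp add: x y power_add mod_eq_dvd_iff flip: right_diff_distrib)
  moreover have "2 ^ v * 2 ^ N dvd x * y"
    using div unfolding v_def by (intro mult_dvd_mono multiplicity_dvd)
  ultimately have "2 ^ (v + N) dvd C * (x * y) + R * (y - x)"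
    by (simp add: power_add)
  moreover have "A * w - (P + R) * x = C * (x * y) + R * (y - x)"
    using eq by (simp add: algebra_simps)
  ultimately have dvd: "2 ^ (multiplicity 2 x + N) dvd A * w - (P + R) * x"
    by (simp add: v_def)
  have lead: "A = P + R" "multiplicity 2 w = multiplicity 2 x"
    using dyadic_leading_coeff[OF nz(1,2) col(1) dvd] small PR by auto
  have "C = 0"
  proof (rule no_quadratic_term_equal_multiplicity[OF nz])
    show "A * (w - y) - P * (x - y) = C * x * y"
      using eq lead(1) by (simp add: algebra_simps)
  qed (use col mult lead div small in auto)
  with small(2) show False by contradiction
qed

section \<open>Determination of the integer coefficients\<close>

text \<open>This translates the alternatives for the shifted coefficients back to the original ones,
  with \<open>t = e1 * c\<close>. The assumption \<open>const\<close> expresses that the form splits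
  into linear factors and has no constant term after the shift. In the first alternative
  \<open>t\<close> is not yet known to vanish, so \<open>e2 * d - t = E * d\<close> is kept.\<close>

lemma coeffs_of_gap:
  fixes E e1 e2 e3 e4 d t :: int
  assumes nz: "E > 0" "e1 > 0" "d \<noteq> 0"
    and prod: "e1 * e4 = e2 * e3"
    and const: "(e2 * d - t) * (e3 * d - t) + E * d * t = 0"
    and gap: "e2 * d - t = E * d \<or> e2 * d - t = 0 \<and> (e3 * d - t = 0 \<or> e3 * d - t = E * d)"
  shows "e4 = 0 \<and> (e3 = 0 \<and> e2 * d - t = E * d \<or> e2 = 0 \<and> (e3 = 0 \<or> e3 = E))"
  using gap
proof
  assume P: "e2 * d - t = E * d"
  have "E * d * (e3 * d - t) + E * d * t = 0"
    using const unfolding P .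
  then have "E * d * (e3 * d) = 0"
    by (simp add: algebra_simps)
  with nz prod P show ?thesis by simp
next
  assume P: "e2 * d - t = 0 \<and> (e3 * d - t = 0 \<or> e3 * d - t = E * d)"
  with const nz have "t = 0" by simp
  with P nz prod show ?thesis by auto
qed

text \<open>
  Here \<open>\<rho> = - c / d\<close>, and \<open>z n = d * n + c\<close> is \<open>n - \<rho>\<close> with denominators cleared.
\<close>

lemma integer_coeffs:
  fixes E e1 e2 e3 e4 e2' e3' e4' :: int
  assumes E: "E > 0" "e1 > 0"
    and prod: "e1 * e4 = e2 * e3" "e1 * e4' = e2' * e3'"
    and mono: "\<And>(\<chi> :: nat \<Rightarrow> int \<times> nat \<times> int \<times> int) M. finite (range \<chi>) \<Longrightarrow>
      \<exists>x y F G. x > M \<and> y > M \<and> F > M \<and> G > M \<and> \<chi> y = \<chi> x \<and> \<chi> F = \<chi> x \<and> \<chi> G = \<chi> x \<and>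
        E * int F = e1 * int x * int y + e2 * int x + e3 * int y + e4 \<and>
        E * int G = e1 * int x * int y + e2' * int x + e3' * int y + e4'"
  shows "e2 = e2' \<and> e3 = e3' \<and> e4 = e4' \<or>
         e2 = e3' \<and> e3 = e2' \<and> e4 = e4' \<or>
         e4 = 0 \<and> e4' = 0 \<and>
           ((e2, e3) = (0, 0) \<and> ((e2', e3') = (E, 0) \<or> (e2', e3') = (0, E)) \<or>
            (e2', e3') = (0, 0) \<and> ((e2, e3) = (E, 0) \<or> (e2, e3) = (0, E)))"
proof -
  \<comment> \<open>On the diagonal, \<open>E\<close> times the difference of the forms is
    \<open>d * x + c\<close>.\<close>
  define c d where "c = e4 - e4'" and "d = e2 + e3 - e2' - e3'"
  \<comment> \<open>These are the coefficients after multiplying by \<open>d\<^sup>2\<close> and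
    substituting \<open>d * n = z n - c\<close>; \<open>K\<close> and \<open>K'\<close> are the
    constant terms.\<close>
  define A P R P' R' where "A = E * d" and "P = e2 * d - e1 * c" and "R = e3 * d - e1 * c"
    and "P' = e2' * d - e1 * c" and "R' = e3' * d - e1 * c"
  define K where "K = e1 * c\<^sup>2 - (e2 + e3) * d * c + e4 * d\<^sup>2 + E * d * c"
  define K' where "K' = e1 * c\<^sup>2 - (e2' + e3') * d * c + e4' * d\<^sup>2 + E * d * c"
  obtain N where N: "N > 0"
    and bound: "\<forall>b\<in>{c, K, K', e1, \<bar>A\<bar> + \<bar>P\<bar> + \<bar>R\<bar>, \<bar>A\<bar> + \<bar>P'\<bar> + \<bar>R'\<bar>}. \<bar>b\<bar> < 2 ^ N"
    using exists_two_power_gt by (metis finite.emptyI finite_insert)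
  \<comment> \<open>Beyond this bound \<open>z n\<close> cannot vanish when
    \<open>d \<noteq> 0\<close>.\<close>
  define M where "M = nat \<bar>c\<bar>"
  define z where "z n = d * int n + c" for n
  \<comment> \<open>The residue of \<open>n\<close> serves to prove \<open>2 ^ N dvd z n\<close> for
    all four entries. The colour type in \<open>mono\<close> is exactly that of this pair, since an
    assumption cannot be polymorphic.\<close>
  define \<chi> where "\<chi> n = (int n mod 2 ^ N, dyadic_colour N (z n))" for n
  have "range \<chi> \<subseteq> {0..<2 ^ N} \<times> range (dyadic_colour N)"
    by (auto simp: \<chi>_def)
  then have "finite (range \<chi>)"
    using finite_range_dyadic_colour[OF N]
    by (meson finite_SigmaI finite_atLeastLessThan_int finite_subset)
  from mono[OF this, of M] obtain x y F G where
    big: "x > M" "y > M" "F > M" "G > M"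
    and eq: "\<chi> y = \<chi> x" "\<chi> F = \<chi> x" "\<chi> G = \<chi> x"
    and F: "E * int F = e1 * int x * int y + e2 * int x + e3 * int y + e4"
    and G: "E * int G = e1 * int x * int y + e2' * int x + e3' * int y + e4'"
    by blast
  have cong: "2 ^ N dvd int y - int x" "2 ^ N dvd int F - int x" "2 ^ N dvd int G - int x"
    using eq by (simp_all add: \<chi>_def mod_eq_dvd_iff)
  have col: "dyadic_colour N (z y) = dyadic_colour N (z x)"
    "dyadic_colour N (z F) = dyadic_colour N (z x)" "dyadic_colour N (z G) = dyadic_colour N (z x)"
    using eq by (simp_all add: \<chi>_def)
  have "z x = E * (int F - int x) - E * (int G - int x) - (e3 - e3') * (int y - int x)"
    using F G by (simp add: z_def c_def d_def algebra_simps)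
  then have zx: "2 ^ N dvd z x"
    using cong by simp
  have zdvd: "2 ^ N dvd z n" if "2 ^ N dvd int n - int x" for n
  proof -
    have "z n = z x + d * (int n - int x)"
      by (simp add: z_def algebra_simps)
    then show ?thesis using zx that by simp
  qed
  show ?thesis
  proof (cases "d = 0")
    case True
    then have "2 ^ N dvd c * 1" using zx by (simp add: z_def)
    then have "c = 0"
      using bound by (intro dyadic_small_eq_0[of N c 1]) auto
    then have e4: "e4 = e4'" by (simp add: c_def)
    \<comment> \<open>The pairs have equal sum and equal product, hence agree up to order.\<close>
    have "e2 * e3 = e2' * e3'"
      using prod e4 by metis
    moreover have "e3 = e2' + e3' - e2"
      using True by (simp add: d_def)
    ultimately have "(e2 - e2') * (e2 - e3') = 0"
      by (simp add: algebra_simps)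
    then consider "e2 = e2'" | "e2 = e3'"
      by auto
    then show ?thesis
      using \<open>e3 = e2' + e3' - e2\<close> e4 by cases simp_all
  next
    case False
    have "z n \<noteq> 0" if "n > M" for n
    proof
      assume "z n = 0"
      then have "\<bar>d\<bar> * int n = \<bar>c\<bar>"
        unfolding z_def by (metis abs_minus_cancel abs_mult abs_of_nat eq_neg_iff_add_eq_0)
      moreover have "1 * int n \<le> \<bar>d\<bar> * int n"
        using False by (intro mult_right_mono) auto
      ultimately show False using that by (simp add: M_def)
    qed
    then have nz: "z x \<noteq> 0" "z y \<noteq> 0" "z F \<noteq> 0" "z G \<noteq> 0"
      using big by blast+
    have "A * z F = d\<^sup>2 * (E * int F) + E * d * c"
      by (simp add: A_def z_def power2_eq_square algebra_simps)
    also have "\<dots> = e1 * z x * z y + P * z x + R * z y + K"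
      unfolding F by (simp add: z_def P_def R_def K_def power2_eq_square algebra_simps)
    finally have zF: "A * z F = e1 * z x * z y + P * z x + R * z y + K" .
    have "A * z G = d\<^sup>2 * (E * int G) + E * d * c"
      by (simp add: A_def z_def power2_eq_square algebra_simps)
    also have "\<dots> = e1 * z x * z y + P' * z x + R' * z y + K'"
      unfolding G by (simp add: z_def P'_def R'_def K'_def power2_eq_square algebra_simps)
    finally have zG: "A * z G = e1 * z x * z y + P' * z x + R' * z y + K'" .
    have dvd: "2 ^ N dvd z y" "2 ^ N dvd z F" "2 ^ N dvd z G"
      using zdvd cong by blast+
    \<comment> \<open>All other terms are divisible by \<open>2 ^ N\<close>, so the constant term
      vanishes: \<open>\<rho>\<close> is a fixed point of the first form on the diagonal.\<close>
    have "K = A * z F - e1 * z x * z y - P * z x - R * z y"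
      using zF by simp
    then have "2 ^ N dvd K * 1"
      using dvd zx by simp
    then have K: "K = 0"
      using bound by (intro dyadic_small_eq_0[of N K 1]) auto
    have "K' = A * z G - e1 * z x * z y - P' * z x - R' * z y"
      using zG by simp
    then have "2 ^ N dvd K' * 1"
      using dvd zx by simp
    then have K': "K' = 0"
      using bound by (intro dyadic_small_eq_0[of N K' 1]) auto
    have A: "A \<noteq> 0" using E False by (simp add: A_def)
    have small: "\<bar>e1\<bar> < 2 ^ N" "\<bar>A\<bar> + \<bar>P\<bar> + \<bar>R\<bar> < 2 ^ N" "\<bar>A\<bar> + \<bar>P'\<bar> + \<bar>R'\<bar> < 2 ^ N"
      "\<bar>A\<bar> + \<bar>R\<bar> + \<bar>P\<bar> < 2 ^ N" "\<bar>A\<bar> + \<bar>R'\<bar> + \<bar>P'\<bar> < 2 ^ N"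
      using bound by (simp_all add: add.assoc add.commute add.left_commute)
    have zF: "A * z F = e1 * z x * z y + P * z x + R * z y"
      "A * z F = e1 * z y * z x + R * z y + P * z x"
      and zG: "A * z G = e1 * z x * z y + P' * z x + R' * z y"
      "A * z G = e1 * z y * z x + R' * z y + P' * z x"
      using zF zG K K' by simp_all
    \<comment> \<open>Combining \<open>K = 0\<close> with the factorisation
      \<open>e1 * e4 = e2 * e3\<close> eliminates \<open>e4\<close>.\<close>
    have "P * R + A * (e1 * c) = e1 * K + d\<^sup>2 * (e2 * e3 - e1 * e4)"
      by (simp add: K_def P_def R_def A_def power2_eq_square algebra_simps)
    then have PR: "P * R + A * (e1 * c) = 0"
      using K prod by simp
    have "P' * R' + A * (e1 * c) = e1 * K' + d\<^sup>2 * (e2' * e3' - e1 * e4')"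
      by (simp add: K'_def P'_def R'_def A_def power2_eq_square algebra_simps)
    then have PR': "P' * R' + A * (e1 * c) = 0"
      using K' prod by simp
    have "multiplicity 2 (z y) mod N = multiplicity 2 (z x) mod N"
      using col(1) by (simp add: dyadic_colour_def Let_def)
    then consider "multiplicity 2 (z y) = multiplicity 2 (z x)"
      | "multiplicity 2 (z x) + N \<le> multiplicity 2 (z y)"
      | "multiplicity 2 (z y) + N \<le> multiplicity 2 (z x)"
      using mod_eq_gap by blast
    then show ?thesis
    proof cases
      case 1
      have "e1 \<noteq> 0" using E by simp
      note coeffs = dyadic_coeffs_of_equal_multiplicity[OF _ nz(1,2) _ col(1) 1 zx dvd(1) _ A this small(1)]
      have "P + R = 0"
        by (rule coeffs[OF nz(3) col(2) zF(1) small(2)])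
      moreover have "P' + R' = 0"
        by (rule coeffs[OF nz(4) col(3) zG(1) small(3)])
      ultimately have "(P + R) - (P' + R') = 0" by simp
      \<comment> \<open>The shift by \<open>c\<close> cancels here, so both sums can vanish only if
        \<open>d = 0\<close>.\<close>
      moreover have "(P + R) - (P' + R') = d * d"
        by (simp add: P_def R_def P'_def R'_def d_def algebra_simps)
      ultimately show ?thesis using False by simp
    next
      case 2
      note coeffs = dyadic_coeffs_of_gap[OF _ nz(1,2) _ col(1) 2 zx _ A]
      have "P = A \<or> P = 0 \<and> (R = 0 \<or> R = A)"
        by (rule coeffs[OF nz(3) col(2) zF(1) small(2)])
      then have F0: "e4 = 0 \<and> (e3 = 0 \<and> P = A \<or> e2 = 0 \<and> (e3 = 0 \<or> e3 = E))"
        using coeffs_of_gap[OF E False prod(1) PR[unfolded P_def R_def A_def]]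
        by (simp only: A_def P_def R_def)
      have "P' = A \<or> P' = 0 \<and> (R' = 0 \<or> R' = A)"
        by (rule coeffs[OF nz(4) col(3) zG(1) small(3)])
      then have G0: "e4' = 0 \<and> (e3' = 0 \<and> P' = A \<or> e2' = 0 \<and> (e3' = 0 \<or> e3' = E))"
        using coeffs_of_gap[OF E False prod(2) PR'[unfolded P'_def R'_def A_def]]
        by (simp only: A_def P'_def R'_def)
      \<comment> \<open>Both constant terms vanish, so \<open>\<rho> = 0\<close> and no shift
        remains. Each pair of linear coefficients is now \<open>(0, 0)\<close>,
        \<open>(E, 0)\<close> or \<open>(0, E)\<close>, and \<open>d \<noteq> 0\<close> makes
        exactly one of them \<open>(0, 0)\<close>.\<close>
      have "c = 0" using F0 G0 by (simp add: c_def)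
      then have "P = A \<longleftrightarrow> e2 = E" "P' = A \<longleftrightarrow> e2' = E"
        using False by (simp_all add: A_def P_def P'_def)
      with F0 G0 False show ?thesis unfolding d_def by auto
    next
      case 3
      \<comment> \<open>The previous case with the roles of \<open>x\<close> and \<open>y\<close>
        exchanged.\<close>
      note coeffs = dyadic_coeffs_of_gap[OF _ nz(2,1) _ col(1)[symmetric] 3 dvd(1) _ A]
      have RP: "R * P + A * (e1 * c) = 0" "R' * P' + A * (e1 * c) = 0"
        using PR PR' by (simp_all only: mult.commute[of R P] mult.commute[of R' P'])
      have prod': "e1 * e4 = e3 * e2" "e1 * e4' = e3' * e2'"
        using prod by (simp_all only: mult.commute[of e3 e2] mult.commute[of e3' e2'])
      have "R = A \<or> R = 0 \<and> (P = 0 \<or> P = A)"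
        by (rule coeffs[OF nz(3) trans[OF col(2) col(1)[symmetric]] zF(2) small(4)])
      then have F0: "e4 = 0 \<and> (e2 = 0 \<and> R = A \<or> e3 = 0 \<and> (e2 = 0 \<or> e2 = E))"
        using coeffs_of_gap[OF E False prod'(1) RP(1)[unfolded P_def R_def A_def]]
        by (simp only: A_def P_def R_def)
      have "R' = A \<or> R' = 0 \<and> (P' = 0 \<or> P' = A)"
        by (rule coeffs[OF nz(4) trans[OF col(3) col(1)[symmetric]] zG(2) small(5)])
      then have G0: "e4' = 0 \<and> (e2' = 0 \<and> R' = A \<or> e3' = 0 \<and> (e2' = 0 \<or> e2' = E))"
        using coeffs_of_gap[OF E False prod'(2) RP(2)[unfolded P'_def R'_def A_def]]
        by (simp only: A_def P'_def R'_def)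
      have "c = 0" using F0 G0 by (simp add: c_def)
      then have "R = A \<longleftrightarrow> e3 = E" "R' = A \<longleftrightarrow> e3' = E"
        using False by (simp_all add: A_def R_def R'_def)
      with F0 G0 False show ?thesis unfolding d_def by auto
    qed
  qed
qed

section \<open>Clearing denominators and return to polynomials\<close>

lemma lin_prod_coeffs:
  "lin_prod q a n b m =
     [:[:q * of_int n * of_int m, q * of_nat a * of_int m:],
       [:q * of_int n * of_nat b, q * of_nat a * of_nat b:]:]"
  by (simp add: lin_prod_def const2_def var_x_def var_y_def of_nat_poly of_int_poly algebra_simps)

lemma clear_denominators:
  fixes q :: rat
  assumes "q = Fract p r" "r > 0"
    and "of_nat F = q * (of_nat a * of_nat u + of_int n) * (of_nat b * of_nat v + of_int m)"
  shows "r * int F = p * (int a * int u + n) * (int b * int v + m)"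
proof -
  have p: "of_int p = q * of_int r"
    using assms(1,2) by (simp add: Fract_of_int_quotient)
  have "of_int (r * int F) = (of_int (p * (int a * int u + n) * (int b * int v + m)) :: rat)"
    using assms(3) by (simp add: p)
  then show ?thesis by (simp only: of_int_eq_iff)
qed

theorem theoremD:
  fixes q1 q2 :: rat and a1 a2 b1 b2 :: nat and n1 n2 m1 m2 :: int
  assumes "q1 > 0" "q2 > 0"
    and "a1 > 0" "a2 > 0" "b1 > 0" "b2 > 0"
    and "partition_regular
           (map eval2 [var_x, var_y, lin_prod q1 a1 n1 b1 m1, lin_prod q2 a2 n2 b2 m2])"
  shows "lin_prod q1 a1 n1 b1 m1 = lin_prod q2 a2 n2 b2 m2 \<or>
         lin_prod q1 a1 n1 b1 m1 = lin_prod q2 b2 m2 a2 n2 \<or>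
         (\<exists>q. q = q1 * of_nat a1 * of_nat b1 \<and> q = q2 * of_nat a2 * of_nat b2 \<and>
            (mset [var_x, var_y, lin_prod q1 a1 n1 b1 m1, lin_prod q2 a2 n2 b2 m2] =
               mset [var_x, var_y, const2 q * var_x * var_y, const2 q * var_x * var_y + var_x] \<or>
             mset [var_x, var_y, lin_prod q1 a1 n1 b1 m1, lin_prod q2 a2 n2 b2 m2] =
               mset [var_x, var_y, const2 q * var_x * var_y, const2 q * var_x * var_y + var_y]))"
proof -
  obtain p1 r1 where q1: "q1 = Fract p1 r1" "r1 > 0" by (cases q1)
  obtain p2 r2 where q2: "q2 = Fract p2 r2" "r2 > 0" by (cases q2)
  have p: "p1 > 0" "p2 > 0"
    using assms(1,2) q1 q2 by (simp_all add: zero_less_Fract_iff)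
  note lead = leading_coeff_eq[OF assms]
  define E where "E = r1 * r2"
  have E: "E > 0" using q1 q2 by (simp add: E_def)
  define k1 k2 where "k1 = p1 * r2" and "k2 = p2 * r1"
  have k: "of_int k1 = of_int E * q1" "of_int k2 = of_int E * q2"
    using q1 q2 by (simp_all add: k1_def k2_def E_def Fract_of_int_quotient)
  have "(of_int (k1 * int a1 * int b1) :: rat) = of_int E * (q1 * of_nat a1 * of_nat b1)"
    by (simp add: k)
  also have "\<dots> = of_int (k2 * int a2 * int b2)"
    unfolding lead by (simp add: k)
  finally have lead_int: "k1 * int a1 * int b1 = k2 * int a2 * int b2"
    by (simp only: of_int_eq_iff)
  \<comment> \<open>These are the coefficients of \<open>x y\<close>, \<open>x\<close>,
    \<open>y\<close> and 1 in \<open>E\<close> times the first form; the second form shares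
    \<open>e1\<close> because the leading coefficients agree.\<close>
  define e1 e2 e3 e4 where "e1 = k1 * int a1 * int b1" and "e2 = k1 * int a1 * m1"
    and "e3 = k1 * n1 * int b1" and "e4 = k1 * n1 * m1"
  define e2' e3' e4' where "e2' = k2 * int a2 * m2"
    and "e3' = k2 * n2 * int b2" and "e4' = k2 * n2 * m2"
  have e1': "e1 = k2 * int a2 * int b2"
    using lead_int by (simp add: e1_def)
  define q where "q = q1 * of_nat a1 * of_nat b1"
  have q: "q1 * of_nat a1 * of_nat b1 = q" "q2 * of_nat a2 * of_nat b2 = q"
    using lead by (simp_all add: q_def)
  have coeff: "of_int (k1 * i) / of_int E = q1 * of_int i" "of_int (k2 * i) / of_int E = q2 * of_int i" for i
    using E by (simp_all add: k)
  \<comment> \<open>In the third equation exchanging the variables swaps \<open>e2'\<close> and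
    \<open>e3'\<close>, so all three conclusions can be read off from the integer
    coefficients.\<close>
  have lp: "lin_prod q1 a1 n1 b1 m1 = [:[:of_int e4 / of_int E, of_int e2 / of_int E:], [:of_int e3 / of_int E, q:]:]"
    "lin_prod q2 a2 n2 b2 m2 = [:[:of_int e4' / of_int E, of_int e2' / of_int E:], [:of_int e3' / of_int E, q:]:]"
    "lin_prod q2 b2 m2 a2 n2 = [:[:of_int e4' / of_int E, of_int e3' / of_int E:], [:of_int e2' / of_int E, q:]:]"
    unfolding lin_prod_coeffs e2_def e3_def e4_def e2'_def e3'_def e4'_def
    by (simp_all only: mult.assoc coeff) (use q in \<open>simp_all add: mult_ac\<close>)
  have "e2 = e2' \<and> e3 = e3' \<and> e4 = e4' \<or>
         e2 = e3' \<and> e3 = e2' \<and> e4 = e4' \<or>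
         e4 = 0 \<and> e4' = 0 \<and>
           ((e2, e3) = (0, 0) \<and> ((e2', e3') = (E, 0) \<or> (e2', e3') = (0, E)) \<or>
            (e2', e3') = (0, 0) \<and> ((e2, e3) = (E, 0) \<or> (e2, e3) = (0, E)))"
  proof (rule integer_coeffs)
    show "E > 0" by fact
    show "e1 > 0" using p q1 q2 assms(3-6) by (simp add: e1_def k1_def)
    show "e1 * e4 = e2 * e3"
      by (simp add: e1_def e2_def e3_def e4_def)
    show "e1 * e4' = e2' * e3'"
      by (simp add: e1' e2'_def e3'_def e4'_def)
  next
    fix \<chi> :: "nat \<Rightarrow> int \<times> nat \<times> int \<times> int" and M
    assume fin: "finite (range \<chi>)"
    obtain x y F G where big: "x > M" "y > M" "F > M" "G > M"
      and col: "\<chi> y = \<chi> x" "\<chi> F = \<chi> x" "\<chi> G = \<chi> x"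
      and F: "of_nat F = eval2 (lin_prod q1 a1 n1 b1 m1) x y"
      and G: "of_nat G = eval2 (lin_prod q2 a2 n2 b2 m2) x y"
      by (rule partition_regular_monochromatic[OF assms(7) fin])
    have "E * int F = r2 * (r1 * int F)" by (simp add: E_def)
    also have "\<dots> = e1 * int x * int y + e2 * int x + e3 * int y + e4"
      unfolding clear_denominators[OF q1 F[unfolded eval2_lin_prod]]
      by (simp add: e1_def e2_def e3_def e4_def k1_def algebra_simps)
    finally have F: "E * int F = e1 * int x * int y + e2 * int x + e3 * int y + e4" .
    have "E * int G = r1 * (r2 * int G)" by (simp add: E_def)
    also have "\<dots> = e1 * int x * int y + e2' * int x + e3' * int y + e4'"
      unfolding clear_denominators[OF q2 G[unfolded eval2_lin_prod]]
      by (simp add: e1' e2'_def e3'_def e4'_def k2_def algebra_simps)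
    finally have G: "E * int G = e1 * int x * int y + e2' * int x + e3' * int y + e4'" .
    show "\<exists>x y F G. x > M \<and> y > M \<and> F > M \<and> G > M \<and> \<chi> y = \<chi> x \<and> \<chi> F = \<chi> x \<and> \<chi> G = \<chi> x \<and>
        E * int F = e1 * int x * int y + e2 * int x + e3 * int y + e4 \<and>
        E * int G = e1 * int x * int y + e2' * int x + e3' * int y + e4'"
      using big col F G by blast
  qed
  then consider (same) "e2 = e2'" "e3 = e3'" "e4 = e4'"
    | (swap) "e2 = e3'" "e3 = e2'" "e4 = e4'"
    | (x) "e4 = 0" "e4' = 0" "e2 = 0" "e3 = 0" "e2' = E" "e3' = 0"
    | (y) "e4 = 0" "e4' = 0" "e2 = 0" "e3 = 0" "e2' = 0" "e3' = E"
    | (x') "e4 = 0" "e4' = 0" "e2' = 0" "e3' = 0" "e2 = E" "e3 = 0"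
    | (y') "e4 = 0" "e4' = 0" "e2' = 0" "e3' = 0" "e2 = 0" "e3 = E"
    by auto
  then show ?thesis
  proof cases
    case same
    then have "lin_prod q1 a1 n1 b1 m1 = lin_prod q2 a2 n2 b2 m2"
      by (simp only: lp)
    then show ?thesis by (rule disjI1)
  next
    case swap
    then have "lin_prod q1 a1 n1 b1 m1 = lin_prod q2 b2 m2 a2 n2"
      by (simp only: lp)
    then show ?thesis by blast
  next
    case x
    then have "lin_prod q1 a1 n1 b1 m1 = const2 q * var_x * var_y"
      "lin_prod q2 a2 n2 b2 m2 = const2 q * var_x * var_y + var_x"
      using E by (simp_all add: lp const2_def var_x_def var_y_def one_pCons)
    then show ?thesis unfolding q by simp
  next
    case y
    then have "lin_prod q1 a1 n1 b1 m1 = const2 q * var_x * var_y"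
      "lin_prod q2 a2 n2 b2 m2 = const2 q * var_x * var_y + var_y"
      using E by (simp_all add: lp const2_def var_x_def var_y_def one_pCons)
    then show ?thesis unfolding q by simp
  next
    case x'
    then have "lin_prod q1 a1 n1 b1 m1 = const2 q * var_x * var_y + var_x"
      "lin_prod q2 a2 n2 b2 m2 = const2 q * var_x * var_y"
      using E by (simp_all add: lp const2_def var_x_def var_y_def one_pCons)
    then show ?thesis unfolding q by (simp add: add_mset_commute)
  next
    case y'
    then have "lin_prod q1 a1 n1 b1 m1 = const2 q * var_x * var_y + var_y"
      "lin_prod q2 a2 n2 b2 m2 = const2 q * var_x * var_y"
      using E by (simp_all add: lp const2_def var_x_def var_y_def one_pCons)
    then show ?thesis unfolding q by (simp add: add_mset_commute)
  qed
qed

end
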